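(* Let $G$ be an SCT graph. If $G$ has a $k$-let with $k\ge 3$, then the Kuramoto variety $\mathbb{V}(I_K)$, taken with the normalization $\theta_0=0$, has positive dimension; that is, the complex affine algebraic set $\mathbb{V}(I_K)\cap\{x_0=1,\ y_0=0\}$ has dimension at least $1$.
   Context: An SCT graph is a finite simple connected graph (no loops or multiple edges) in which every vertex has degree at least $2$. Let $n$ be the number of vertices of $G$, label the vertices $v_0,\ldots,v_{n-1}$, and let $G_i$ (also written $G_{v_i}$) be the set of vertices adjacent to $v_i$. In $\mathbb{C}[x_0,\ldots,x_{n-1},y_0,\ldots,y_{n-1}]$ put $$f_i=\sum_{v_j\in G_i}(x_jy_i-x_iy_j),\qquad I_G=\langle f_0,\ldots,f_{n-1}\rangle,$$ $$I_\theta=\langle x_0^2+y_0^2-1,\ldots,x_{n-1}^2+y_{n-1}^2-1\rangle,\qquad I_K=I_\theta+I_G.$$ The Kuramoto variety $\mathbb{V}(I_K)\subset\mathbb{C}^{2n}$ is the set of common zeros of $I_K$. Each pair $(x_i,y_i)$ encodes an angle $\theta_i$ through its sine and cosine. The system is invariant under simultaneous rotation of all angles, and this trivial symmetry is removed by the normalization $\theta_0=0$, i.e. by setting $x_0=1$, $y_0=0$. A $k$-let is a set $S$ of $k$ distinct vertices of $G$ such that $G_v=G_w$ for all $v,w\in S$. *)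

theory Defs
  imports
    "HOL-Library.Poly_Mapping"
    "HOL-Library.Extended_Real"
    "Graph_Theory.Graph_Theory"
begin

section \<open>SCT graphs\<close>

text \<open>
  \<^term>\<open>pair_graph G\<close> says that \<^term>\<open>G\<close> is a finite symmetric loop-free digraph whose arcs
  are pairs of vertices, i.e. a finite simple graph with each edge stored in both directions.
\<close>

definition nbhd :: "'v pair_pre_digraph \<Rightarrow> 'v \<Rightarrow> 'v set" where
  "nbhd G v = {w. (v, w) \<in> parcs G}"

definition sct_graph :: "'v pair_pre_digraph \<Rightarrow> bool" where
  "sct_graph G \<longleftrightarrow>
     pair_graph G \<and> Digraph_Component.connected (with_proj G) \<and>
     (\<forall>v \<in> pverts G. 2 \<le> card (nbhd G v))"

definition klet :: "'v pair_pre_digraph \<Rightarrow> nat \<Rightarrow> 'v set \<Rightarrow> bool" where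
  "klet G k S \<longleftrightarrow>
     S \<subseteq> pverts G \<and> finite S \<and> card S = k \<and> (\<forall>v \<in> S. \<forall>w \<in> S. nbhd G v = nbhd G w)"


section \<open>Polynomials, ideals and zero loci\<close>

text \<open>
  A polynomial over \<open>\<complex>\<close> in indeterminates indexed by \<open>'i\<close> is a finitely supported function
  from monomials (finitely supported exponent vectors) to coefficients; ring operations are
  those of \<^theory>\<open>HOL-Library.Poly_Mapping\<close>.
\<close>

type_synonym 'i cpoly = "('i \<Rightarrow>\<^sub>0 nat) \<Rightarrow>\<^sub>0 complex"

definition pvar :: "'i \<Rightarrow> 'i cpoly" where
  "pvar i = Poly_Mapping.single (Poly_Mapping.single i 1) 1"

definition peval :: "('i \<Rightarrow> complex) \<Rightarrow> 'i cpoly \<Rightarrow> complex" where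
  "peval a p =
     (\<Sum>m \<in> Poly_Mapping.keys p. Poly_Mapping.lookup p m *
        (\<Prod>i \<in> Poly_Mapping.keys m. a i ^ Poly_Mapping.lookup m i))"

text \<open>The ideal generated by a set: the span in the ring viewed as a module over itself.\<close>

definition ideal_gen :: "'a::comm_ring_1 set \<Rightarrow> 'a set" where
  "ideal_gen B = module.span (*) B"

lemma module_mult: "module ((*) :: 'a::comm_ring_1 \<Rightarrow> 'a \<Rightarrow> 'a)"
  by unfold_locales (simp_all add: algebra_simps)

definition ideal_sum :: "'a::comm_ring_1 set \<Rightarrow> 'a set \<Rightarrow> 'a set" where
  "ideal_sum I J = {p + q | p q. p \<in> I \<and> q \<in> J}"

definition zero_locus :: "'i cpoly set \<Rightarrow> ('i \<Rightarrow> complex) set" where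
  "zero_locus P = {a. \<forall>p \<in> P. peval a p = 0}"


section \<open>Zariski topology and dimension\<close>

text \<open>Intended for a finite index type \<open>'i\<close>, where \<open>'i \<Rightarrow> complex\<close> is an affine space.\<close>

definition zariski_closed :: "('i::finite \<Rightarrow> complex) set \<Rightarrow> bool" where
  "zariski_closed Z \<longleftrightarrow> (\<exists>P. Z = zero_locus P)"

definition zariski_irreducible :: "('i::finite \<Rightarrow> complex) set \<Rightarrow> bool" where
  "zariski_irreducible Z \<longleftrightarrow>
     Z \<noteq> {} \<and>
     (\<forall>A B. zariski_closed A \<and> zariski_closed B \<and> Z \<subseteq> A \<union> B \<longrightarrow> Z \<subseteq> A \<or> Z \<subseteq> B)"

text \<open>
  The dimension of an algebraic set is its Krull dimension: the supremum of the lengths \<open>d\<close> of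
  strict chains \<open>Z 0 \<subset> \<dots> \<subset> Z d\<close> of irreducible closed subsets.  The empty set has no such
  chain, so its dimension is \<open>-\<infinity>\<close>.
\<close>

definition alg_dim :: "('i::finite \<Rightarrow> complex) set \<Rightarrow> ereal" where
  "alg_dim V =
     (SUP d \<in> {d :: nat. \<exists>Z :: nat \<Rightarrow> ('i \<Rightarrow> complex) set.
         (\<forall>j \<le> d. zariski_closed (Z j) \<and> zariski_irreducible (Z j) \<and> Z j \<subseteq> V) \<and>
         (\<forall>j < d. Z j \<subset> Z (Suc j))}. ereal (real d))"


section \<open>The Kuramoto ideal and variety\<close>

text \<open>
  The vertices will be all the elements of a finite type \<open>'v\<close>, so that \<open>'v kvar\<close> indexes
  exactly the indeterminates \<open>x\<^sub>v, y\<^sub>v\<close>, one pair for each vertex.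
\<close>

datatype 'v kvar = X 'v | Y 'v

lemma UNIV_kvar: "(UNIV :: 'v kvar set) = range X \<union> range Y"
proof -
  have "z \<in> range X \<union> range Y" for z :: "'v kvar" by (cases z) auto
  then show ?thesis by blast
qed

instance kvar :: (finite) finite
  by standard (simp add: UNIV_kvar)

definition kuramoto_poly :: "'v pair_pre_digraph \<Rightarrow> 'v \<Rightarrow> 'v kvar cpoly" where
  "kuramoto_poly G v =
     (\<Sum>w \<in> nbhd G v. pvar (X w) * pvar (Y v) - pvar (X v) * pvar (Y w))"

definition I_graph :: "'v pair_pre_digraph \<Rightarrow> 'v kvar cpoly set" where
  "I_graph G = ideal_gen (kuramoto_poly G ` pverts G)"

definition I_theta :: "'v pair_pre_digraph \<Rightarrow> 'v kvar cpoly set" where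
  "I_theta G = ideal_gen ((\<lambda>v. pvar (X v) ^ 2 + pvar (Y v) ^ 2 - 1) ` pverts G)"

definition I_kuramoto :: "'v pair_pre_digraph \<Rightarrow> 'v kvar cpoly set" where
  "I_kuramoto G = ideal_sum (I_theta G) (I_graph G)"

definition kuramoto_variety :: "'v pair_pre_digraph \<Rightarrow> ('v kvar \<Rightarrow> complex) set" where
  "kuramoto_variety G = zero_locus (I_kuramoto G)"

end

theory Submission
  imports Defs "HOL-Complex_Analysis.Conformal_Mappings"
begin

text \<open>
  Three vertices of the \<open>k\<close>-let have a common neighbourhood \<open>N\<close>. The idea is to find an equilibrium
  in which the unit vectors over \<open>N\<close> add up to zero. Then the equations at the three vertices hold
  whatever their own angles are, and the rest of the graph feels them only through the sum \<open>\<kappa>\<close> of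
  their three unit vectors. Two complex conditions (the sum of the exponentials \<open>Z\<close> and the sum of
  the \<open>1 / Z\<close>) on three complex angles leave a one-parameter family
  (\<open>holomorphic_triple_curve\<close>).

  It remains to solve the system on the other vertices together with the condition on \<open>N\<close>, with \<open>\<kappa>\<close>
  free. This is a constrained critical point problem: the Kuramoto equations are the critical point
  equations of the quadratic energy of the graph, and \<open>\<kappa>\<close> enters them as the Lagrange multiplier of
  the constraint that the unit vectors over \<open>N\<close> add up to zero. A real solution always exists
  (\<open>constrained_critical_point\<close>). If \<open>N\<close> is even, angles \<open>0\<close> and \<open>\<pi>\<close> suffice. If \<open>N\<close> is odd,
  the constraint is regular and a limit of penalised minimisers gives the multiplier. The multiplier
  may be longer than three unit vectors can reach, but complex angles realise it nevertheless.

  For the dimension, the family is a holomorphic curve in the variety, and the Zariski closure of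
  such a curve is irreducible by the identity theorem (\<open>zariski_irreducible_closure_curve\<close>). The
  three vertices move relative to the fixed vertices over \<open>N\<close>, so the curve stays nonconstant after
  normalising the angle at any vertex.
\<close>

unbundle no fps_syntax

section \<open>Evaluation of polynomials\<close>

lemma poly_mapping_additive_induct [case_names zero single add]:
  assumes "P 0" and "\<And>m c. P (Poly_Mapping.single m c)" and "\<And>p q. P p \<Longrightarrow> P q \<Longrightarrow> P (p + q)"
  shows "P (p :: 'a \<Rightarrow>\<^sub>0 'b::monoid_add)"
proof (induction p rule: update_induct)
  case const
  show ?case by (rule assms(1))
next
  case (update f m c)
  have "Poly_Mapping.update m c f = f + Poly_Mapping.single m c"
    using update(1) by (intro poly_mapping_eqI)
      (auto simp: lookup_update lookup_add lookup_single when_def in_keys_iff)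
  then show ?case using assms update by metis
qed

lemma peval_add: "peval a (p + q) = peval a p + peval a q"
  unfolding peval_def by (rule setsum_keys_plus_distrib) (simp_all add: algebra_simps)

lemma peval_0: "peval a 0 = 0"
  by (simp add: peval_def)

lemma peval_single:
  "peval a (Poly_Mapping.single m c) =
     c * (\<Prod>i\<in>Poly_Mapping.keys m. a i ^ Poly_Mapping.lookup m i)"
  by (cases "c = 0") (simp_all add: peval_def)

lemma monomial_value_add:
  fixes a :: "'i \<Rightarrow> complex"
  shows "(\<Prod>i\<in>Poly_Mapping.keys (m + n). a i ^ Poly_Mapping.lookup (m + n) i) =
    (\<Prod>i\<in>Poly_Mapping.keys m. a i ^ Poly_Mapping.lookup m i) *
    (\<Prod>i\<in>Poly_Mapping.keys n. a i ^ Poly_Mapping.lookup n i)"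
proof -
  let ?K = "Poly_Mapping.keys m \<union> Poly_Mapping.keys n"
  have extend: "(\<Prod>i\<in>Poly_Mapping.keys k. a i ^ Poly_Mapping.lookup k i) =
      (\<Prod>i\<in>?K. a i ^ Poly_Mapping.lookup k i)" if "Poly_Mapping.keys k \<subseteq> ?K" for k
    using that by (intro prod.mono_neutral_left) (auto simp: in_keys_iff)
  show ?thesis
    using extend[of m] extend[of n] extend[of "m + n"] keys_add[of m n]
    by (simp add: lookup_add power_add prod.distrib)
qed

lemma peval_mult: "peval a (p * q) = peval a p * peval a q"
proof (induction p rule: poly_mapping_additive_induct)
  case (single m c)
  show ?case
    by (induction q rule: poly_mapping_additive_induct)
      (simp_all add: peval_0 peval_add peval_single mult_single monomial_value_add algebra_simps)
qed (simp_all add: peval_0 peval_add algebra_simps)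

lemma peval_const: "peval a (Poly_Mapping.single 0 c) = c"
  by (simp add: peval_single)

lemma peval_1: "peval a 1 = 1"
  using peval_const[of a 1] by simp

lemma peval_pvar: "peval a (pvar i) = a i"
  by (simp add: pvar_def peval_single)

lemma peval_diff: "peval a (p - q) = peval a p - peval a q"
  using peval_add[of a "p - q" q] by simp

lemma peval_sum: "peval a (sum f A) = (\<Sum>x\<in>A. peval a (f x))"
  by (induction A rule: infinite_finite_induct) (simp_all add: peval_0 peval_add)

lemma peval_power: "peval a (p ^ n) = peval a p ^ n"
  by (induction n) (simp_all add: peval_1 peval_mult)

lemmas peval_simps = peval_0 peval_1 peval_add peval_mult peval_const peval_pvar peval_diff
  peval_sum peval_power

lemma holomorphic_on_peval:
  assumes "\<And>i. (\<lambda>s. \<phi> s i) holomorphic_on D"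
  shows "(\<lambda>s. peval (\<phi> s) p) holomorphic_on D"
  unfolding peval_def by (intro holomorphic_intros assms)

lemma zero_locus_ideal_gen: "zero_locus (ideal_gen B) = zero_locus B"
proof -
  interpret R: module "(*) :: 'a cpoly \<Rightarrow> 'a cpoly \<Rightarrow> 'a cpoly"
    by (rule module_mult)
  have "R.span B \<subseteq> {p. peval a p = 0}" if "a \<in> zero_locus B" for a
    using that by (intro R.span_minimal R.subspaceI) (auto simp: zero_locus_def peval_simps)
  moreover have "B \<subseteq> R.span B"
    by (rule R.span_superset)
  ultimately show ?thesis
    unfolding ideal_gen_def zero_locus_def by blast
qed

lemma zero_locus_ideal_sum:
  "zero_locus (ideal_sum (ideal_gen B) (ideal_gen C)) = zero_locus B \<inter> zero_locus C"
proof -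
  interpret R: module "(*) :: 'a cpoly \<Rightarrow> 'a cpoly \<Rightarrow> 'a cpoly"
    by (rule module_mult)
  have "ideal_gen B \<union> ideal_gen C \<subseteq> ideal_sum (ideal_gen B) (ideal_gen C)"
    unfolding ideal_sum_def ideal_gen_def using R.span_zero by force
  then have "zero_locus (ideal_sum (ideal_gen B) (ideal_gen C)) \<subseteq>
      zero_locus (ideal_gen B) \<inter> zero_locus (ideal_gen C)"
    by (auto simp: zero_locus_def)
  moreover have "zero_locus (ideal_gen B) \<inter> zero_locus (ideal_gen C) \<subseteq>
      zero_locus (ideal_sum (ideal_gen B) (ideal_gen C))"
    by (auto simp: zero_locus_def ideal_sum_def peval_simps)
  ultimately show ?thesis
    by (auto simp: zero_locus_ideal_gen)
qed

section \<open>Analytic curves and dimension\<close>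

lemma holomorphic_mult_eq_0:
  assumes "open D" "topological_space_class.connected D" "f holomorphic_on D" "g holomorphic_on D"
    and "\<And>z. z \<in> D \<Longrightarrow> f z * g z = 0"
  shows "(\<forall>z\<in>D. f z = 0) \<or> (\<forall>z\<in>D. g z = 0)"
proof (cases "\<forall>z\<in>D. f z = 0")
  case False
  define U where "U = {z \<in> D. f z \<noteq> 0}"
  have "open U"
  proof -
    have "open (D \<inter> f -` (- {0}))"
      using assms by (intro continuous_open_preimage holomorphic_on_imp_continuous_on) auto
    then show ?thesis by (simp add: U_def vimage_def Int_def)
  qed
  moreover have "U \<noteq> {}" and "U \<subseteq> D"
    using False by (auto simp: U_def)
  moreover have "g z = 0" if "z \<in> U" for z
    using that assms(5)[of z] by (simp add: U_def)
  ultimately have "g z = 0" if "z \<in> D" for z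
    using analytic_continuation_open[of U D g "\<lambda>_. 0" z] assms(1,2,4) that by simp
  then show ?thesis by simp
qed simp

lemma zariski_closed_singleton: "zariski_closed {a}"
  unfolding zariski_closed_def
proof
  show "{a} = zero_locus (range (\<lambda>i. pvar i - Poly_Mapping.single 0 (a i)))"
    by (auto simp: zero_locus_def peval_simps)
qed

lemma zariski_irreducible_singleton: "zariski_irreducible {a}"
  by (auto simp: zariski_irreducible_def)

text \<open>
  The coordinate ring of the closure embeds into the ring of holomorphic functions on \<open>D\<close>, which
  has no zero divisors because \<open>D\<close> is connected.
\<close>

lemma zariski_irreducible_closure_curve:
  fixes \<phi> :: "complex \<Rightarrow> 'i::finite \<Rightarrow> complex"
  assumes D: "open D" "topological_space_class.connected D" "D \<noteq> {}"
    and hol: "\<And>i. (\<lambda>s. \<phi> s i) holomorphic_on D"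
  shows "zariski_irreducible (zero_locus {p. \<forall>s\<in>D. peval (\<phi> s) p = 0})" (is "zariski_irreducible ?Z")
  unfolding zariski_irreducible_def
proof (intro conjI allI impI)
  have curve: "\<phi> s \<in> ?Z" if "s \<in> D" for s
    using that by (auto simp: zero_locus_def)
  then show "?Z \<noteq> {}"
    using D by blast
  fix A B :: "('i \<Rightarrow> complex) set"
  assume AB: "zariski_closed A \<and> zariski_closed B \<and> ?Z \<subseteq> A \<union> B"
  then obtain P Q where P: "A = zero_locus P" and Q: "B = zero_locus Q"
    by (auto simp: zariski_closed_def)
  have "(\<forall>s\<in>D. peval (\<phi> s) p = 0) \<or> (\<forall>s\<in>D. peval (\<phi> s) q = 0)" if "p \<in> P" "q \<in> Q" for p q
    using AB curve that unfolding P Q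
    by (intro holomorphic_mult_eq_0 D holomorphic_on_peval hol) (auto simp: zero_locus_def)
  then have "P \<subseteq> {p. \<forall>s\<in>D. peval (\<phi> s) p = 0} \<or> Q \<subseteq> {p. \<forall>s\<in>D. peval (\<phi> s) p = 0}"
    by blast
  then show "?Z \<subseteq> A \<or> ?Z \<subseteq> B"
    unfolding P Q by (auto simp: zero_locus_def)
qed

text \<open>
  The chain is a point of the curve inside the Zariski closure of the curve.
\<close>

lemma alg_dim_ge_1_if_holomorphic_curve:
  fixes \<phi> :: "complex \<Rightarrow> 'i::finite \<Rightarrow> complex"
  assumes V: "zariski_closed V" and "\<phi> ` D \<subseteq> V"
    and D: "open D" "topological_space_class.connected D"
    and hol: "\<And>i. (\<lambda>s. \<phi> s i) holomorphic_on D"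
    and st: "s \<in> D" "t \<in> D" "\<phi> s \<noteq> \<phi> t"
  shows "alg_dim V \<ge> 1"
proof -
  define C where "C = zero_locus {p. \<forall>s\<in>D. peval (\<phi> s) p = 0}"
  define Z where "Z j = (if j = 0 then {\<phi> s} else C)" for j :: nat
  have "C \<subseteq> V"
    using V \<open>\<phi> ` D \<subseteq> V\<close> by (fastforce simp: C_def zero_locus_def zariski_closed_def)
  moreover have "{\<phi> s, \<phi> t} \<subseteq> C"
    using st by (auto simp: C_def zero_locus_def)
  moreover have "zariski_irreducible C"
    using D hol st unfolding C_def by (intro zariski_irreducible_closure_curve) auto
  moreover have "zariski_closed C"
    by (auto simp: C_def zariski_closed_def)
  ultimately have "(\<forall>j\<le>1. zariski_closed (Z j) \<and> zariski_irreducible (Z j) \<and> Z j \<subseteq> V) \<and>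
      (\<forall>j<1. Z j \<subset> Z (Suc j))"
    using st zariski_closed_singleton zariski_irreducible_singleton by (auto simp: Z_def)
  then have "ereal (real 1) \<le> alg_dim V"
    unfolding alg_dim_def by (intro SUP_upper CollectI exI[of _ Z])
  then show ?thesis by (simp add: one_ereal_def)
qed

section \<open>Critical points of a quadratic energy on the torus\<close>

text \<open>
  Think of a symmetric matrix \<open>m\<close> as the coupling of oscillators with phases \<open>z v\<close> on the unit
  circle. The energy is the real quadratic form of \<open>m\<close>, and \<open>field_at m z v\<close> is the pull of all
  oscillators on the one at \<open>v\<close>, which is in equilibrium if and only if this pull is radial.
\<close>

definition field_at :: "('v::finite \<Rightarrow> 'v \<Rightarrow> real) \<Rightarrow> ('v \<Rightarrow> complex) \<Rightarrow> 'v \<Rightarrow> complex" where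
  "field_at m z v = (\<Sum>w\<in>UNIV. of_real (m v w) * z w)"

definition energy :: "('v::finite \<Rightarrow> 'v \<Rightarrow> real) \<Rightarrow> ('v \<Rightarrow> complex) \<Rightarrow> real" where
  "energy m z = (\<Sum>v\<in>UNIV. Re (cnj (z v) * field_at m z v))"

definition on_torus :: "('v \<Rightarrow> complex) \<Rightarrow> bool" where
  "on_torus z \<longleftrightarrow> (\<forall>v. cmod (z v) = 1)"

text \<open>
  The energy is affine in one unit coordinate when the others stay fixed: the diagonal term
  \<open>m v v * cmod (z v) ^ 2\<close> is constant on the circle and has to be taken out of the field.
\<close>

lemma energy_update:
  assumes sym: "\<And>v w. m v w = m w v" and \<zeta>: "cmod \<zeta> = cmod (z v)"
  shows "energy m (z(v := \<zeta>)) - energy m z =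
    2 * Re (cnj (\<zeta> - z v) * (field_at m z v - of_real (m v v) * z v))"
proof -
  define h where "h = \<zeta> - z v"
  \<comment> \<open>The update written as the addition of a vector supported at \<open>v\<close>.\<close>
  define \<delta> where "\<delta> u = (if u = v then h else 0)" for u
  have energy_Re: "energy m y = Re (\<Sum>u\<in>UNIV. cnj (y u) * field_at m y u)" for y
    by (simp add: energy_def)
  have upd: "(z(v := \<zeta>)) u = z u + \<delta> u" for u
    by (simp add: \<delta>_def h_def)
  have field: "field_at m (z(v := \<zeta>)) u = field_at m z u + of_real (m u v) * h" for u
    unfolding field_at_def upd
    by (simp add: algebra_simps sum.distrib \<delta>_def if_distrib[of "\<lambda>x. _ * x"] cong: if_cong)
  have cross: "(\<Sum>u\<in>UNIV. cnj (z u) * (of_real (m u v) * h)) = cnj (field_at m z v) * h"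
    by (simp add: field_at_def sum_distrib_left sum_distrib_right sym[of _ v] mult_ac)
  have "(\<Sum>u\<in>UNIV. cnj ((z(v := \<zeta>)) u) * field_at m (z(v := \<zeta>)) u) =
      (\<Sum>u\<in>UNIV. cnj (z u) * field_at m z u) + (\<Sum>u\<in>UNIV. cnj (z u) * (of_real (m u v) * h)) +
      (\<Sum>u\<in>UNIV. cnj (\<delta> u) * (field_at m z u + of_real (m u v) * h))"
    unfolding field unfolding upd by (simp add: algebra_simps sum.distrib)
  also have "(\<Sum>u\<in>UNIV. cnj (\<delta> u) * (field_at m z u + of_real (m u v) * h)) =
      cnj h * (field_at m z v + of_real (m v v) * h)"
    by (simp add: \<delta>_def if_distrib[of cnj] if_distrib[of "\<lambda>x. x * _"] cong: if_cong)
  finally have "energy m (z(v := \<zeta>)) = energy m z +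
      Re (cnj (field_at m z v) * h + cnj h * (field_at m z v + of_real (m v v) * h))"
    unfolding energy_Re by (simp only: cross plus_complex.sel add.assoc)
  moreover have "cmod (z v + h) = cmod (z v)"
    using \<zeta> by (simp add: h_def)
  then have "(Re (z v) + Re h)\<^sup>2 + (Im (z v) + Im h)\<^sup>2 = (Re (z v))\<^sup>2 + (Im (z v))\<^sup>2"
    by (simp add: cmod_def)
  then have "Re (cnj h * h) = - 2 * Re (cnj h * z v)"
    by (simp add: power2_eq_square algebra_simps)
  then have "m v v * Re (cnj h * h) = m v v * (- 2 * Re (cnj h * z v))"
    by (simp only:)
  ultimately show ?thesis
    unfolding h_def[symmetric] by (simp add: algebra_simps)
qed

text \<open>
  A linear functional on the circle is minimal only at the direction opposite to its gradient
  \<open>e\<close>, which is the competitor used below.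
\<close>

lemma minimal_on_circle_imp_parallel:
  assumes "cmod u = 1" and min: "\<And>\<zeta>. cmod \<zeta> = 1 \<Longrightarrow> Re (cnj u * e) \<le> Re (cnj \<zeta> * e)"
  shows "Im (cnj u * e) = 0"
proof (cases "e = 0")
  case False
  have "cnj (- e / of_real (cmod e)) * e = - of_real (cmod e)"
    using False complex_norm_square[of e] by (simp add: field_simps power2_eq_square)
  then have "Re (cnj u * e) \<le> - cmod e"
    using min[of "- e / of_real (cmod e)"] False by (simp add: norm_divide)
  moreover have "cmod (cnj u * e) = cmod e"
    using assms by (simp add: norm_mult)
  ultimately have "\<bar>Re (cnj u * e)\<bar> = cmod (cnj u * e)"
    using abs_Re_le_cmod[of "cnj u * e"] by linarith
  then show ?thesis
    using cmod_eq_Re abs_eq_iff by (smt (verit) cmod_power2 power2_abs zero_eq_power2)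
qed simp

lemma energy_minimum_imp_critical:
  assumes sym: "\<And>v w. m v w = m w v" and z: "on_torus z"
    and min: "\<And>y. on_torus y \<Longrightarrow> energy m z \<le> energy m y"
  shows "Im (cnj (z v) * field_at m z v) = 0"
proof -
  define e where "e = field_at m z v - of_real (m v v) * z v"
  have "Im (cnj (z v) * e) = 0"
  proof (rule minimal_on_circle_imp_parallel)
    show "cmod (z v) = 1"
      using z by (simp add: on_torus_def)
    fix \<zeta> :: complex
    assume "cmod \<zeta> = 1"
    then have "on_torus (z(v := \<zeta>))" and "cmod \<zeta> = cmod (z v)"
      using z by (auto simp: on_torus_def)
    then show "Re (cnj (z v) * e) \<le> Re (cnj \<zeta> * e)"
      using energy_update[of m \<zeta> z v] sym min[of "z(v := \<zeta>)"] by (simp add: e_def algebra_simps)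
  qed
  then show ?thesis
    by (simp add: e_def algebra_simps)
qed

lemma compact_torus: "compact {x :: complex ^ 'v. on_torus (($) x)}"
proof -
  let ?T = "{x :: complex ^ 'v. on_torus (($) x)}"
  have "closed (\<Inter>v. {x :: complex ^ 'v. cmod (x $ v) = 1})"
    by (intro closed_INT ballI closed_Collect_eq continuous_intros)
  moreover have "?T = (\<Inter>v. {x. cmod (x $ v) = 1})"
    by (auto simp: on_torus_def)
  ultimately have "closed ?T"
    by simp
  moreover have "norm x \<le> CARD('v)" if "on_torus (($) x)" for x :: "complex ^ 'v"
    using L2_set_le_sum[of UNIV "\<lambda>v. norm (x $ v)"] that by (simp add: norm_vec_def on_torus_def)
  then have "bounded ?T"
    by (auto simp: bounded_iff)
  ultimately show ?thesis
    by (simp add: compact_eq_bounded_closed)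
qed

lemma energy_minimum_exists:
  fixes m :: "'v::finite \<Rightarrow> 'v \<Rightarrow> real"
  obtains z where "on_torus z" "\<And>y. on_torus y \<Longrightarrow> energy m z \<le> energy m y"
proof -
  let ?T = "{x :: complex ^ 'v. on_torus (($) x)}"
  have "(\<chi> v. 1) \<in> ?T"
    by (simp add: on_torus_def)
  moreover have "continuous_on ?T (\<lambda>x. energy m (($) x))"
    unfolding energy_def field_at_def by (intro continuous_intros)
  ultimately obtain x where x: "x \<in> ?T" "\<And>y. y \<in> ?T \<Longrightarrow> energy m (($) x) \<le> energy m (($) y)"
    using continuous_attains_inf[OF compact_torus] by (metis empty_iff)
  show ?thesis
  proof (rule that[of "($) x"])
    fix y :: "'v \<Rightarrow> complex"
    assume "on_torus y"
    then show "energy m (($) x) \<le> energy m y"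
      using x(2)[of "\<chi> v. y v"] by (simp add: vec_lambda_inverse)
  qed (use x in simp)
qed

lemma on_torus_sequence_limit:
  fixes z :: "nat \<Rightarrow> 'v::finite \<Rightarrow> complex"
  assumes "\<And>n. on_torus (z n)"
  shows "\<exists>r y. strict_mono r \<and> on_torus y \<and> (\<forall>v. (\<lambda>n. z (r n) v) \<longlonglongrightarrow> y v)"
proof -
  let ?T = "{x :: complex ^ 'v. on_torus (($) x)}"
  have "\<forall>n. (\<chi> v. z n v) \<in> ?T"
    using assms by (simp add: on_torus_def)
  then obtain x r where "x \<in> ?T" "strict_mono r"
    and lim: "((\<lambda>n. \<chi> v. z n v) \<circ> r) \<longlonglongrightarrow> x"
    using compact_torus[where 'v = 'v] unfolding compact_def by metis
  moreover have "(\<lambda>n. z (r n) v) \<longlonglongrightarrow> x $ v" for v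
    using tendsto_vec_nth[OF lim, of v] by (simp add: o_def)
  ultimately show ?thesis
    by (intro exI[of _ r] exI[of _ "($) x"]) simp
qed

section \<open>Unit vectors with vanishing sum\<close>

lemma zero_sum_signs:
  assumes "even (card N)" "finite N"
  obtains z :: "'v \<Rightarrow> complex" where "\<And>v. z v = 1 \<or> z v = -1" "(\<Sum>v\<in>N. z v) = 0"
proof -
  obtain B where B: "B \<subseteq> N" "card B = card N div 2" "finite B"
    by (meson div_le_dividend obtain_subset_with_card_n)
  have "(\<Sum>v\<in>N. if v \<in> B then 1 else - 1 :: complex) = of_nat (card B) - of_nat (card (N - B))"
    using assms B by (simp add: sum.If_cases Int_absorb1 Diff_eq)
  also have "card (N - B) = card B"
    using assms B by (simp add: card_Diff_subset) presburger
  finally show ?thesis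
    using that[of "\<lambda>v. if v \<in> B then 1 else - 1"] by auto
qed

text \<open>
  Signs cancel in pairs; if the number of vertices is odd, three of them take the cube roots of
  unity instead.
\<close>

lemma zero_sum_on_torus:
  assumes "card N \<ge> 2"
  obtains z :: "'v \<Rightarrow> complex" where "on_torus z" "(\<Sum>v\<in>N. z v) = 0"
proof (cases "even (card N)")
  case True
  then obtain z :: "'v \<Rightarrow> complex" where "\<And>v. z v = 1 \<or> z v = -1" "(\<Sum>v\<in>N. z v) = 0"
    using zero_sum_signs assms card.infinite by (metis not_numeral_le_zero)
  moreover from this have "on_torus z"
    unfolding on_torus_def by (metis norm_minus_cancel norm_one)
  ultimately show ?thesis
    using that by blast
next
  case False
  have "finite N"
    using assms card.infinite by force
  have "3 \<le> card N"
    using False assms by presburger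
  then obtain T where "T \<subseteq> N" "card T = 3" "finite T"
    by (meson obtain_subset_with_card_n)
  then obtain a b c where T: "T = {a, b, c}" "a \<noteq> b" "a \<noteq> c" "b \<noteq> c"
    by (metis card_3_iff)
  have "even (card (N - T))"
    using False \<open>T \<subseteq> N\<close> \<open>card T = 3\<close> \<open>finite T\<close> \<open>3 \<le> card N\<close> by (simp add: card_Diff_subset)
  then obtain s :: "'v \<Rightarrow> complex" where s: "\<And>v. s v = 1 \<or> s v = -1" "(\<Sum>v\<in>N - T. s v) = 0"
    using zero_sum_signs \<open>finite N\<close> by blast
  define \<omega> where "\<omega> = Complex (- 1 / 2) (sqrt 3 / 2)"
  define z where "z = s(a := 1, b := \<omega>, c := cnj \<omega>)"
  have "cmod \<omega> = 1"
    by (simp add: \<omega>_def cmod_def power_divide)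
  have "cmod (s v) = 1" for v
    using s(1)[of v] by auto
  then have "on_torus z"
    using \<open>cmod \<omega> = 1\<close> by (simp add: z_def on_torus_def)
  moreover have "(\<Sum>v\<in>N - T. z v) = 0"
    using s(2) by (simp add: z_def T)
  moreover have "(\<Sum>v\<in>T. z v) = 0"
    using T by (simp add: z_def \<omega>_def complex_eq_iff)
  ultimately show ?thesis
    using that sum.subset_diff[OF \<open>T \<subseteq> N\<close> \<open>finite N\<close>, of z] by simp
qed

text \<open>
  Collinear unit vectors differ by signs only, and an odd number of signs does not add up to
  zero. This is the regularity of the constraint \<open>(\<Sum>v\<in>N. z v) = 0\<close> that makes Lagrange
  multipliers bounded.
\<close>

lemma odd_zero_sum_imp_not_collinear:
  assumes "odd (card N)" "on_torus z" "(\<Sum>v\<in>N. z v) = 0"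
  obtains v w where "v \<in> N" "w \<in> N" "Im (cnj (z v) * z w) \<noteq> 0"
proof (rule ccontr)
  assume "\<not> thesis"
  with that have collinear: "\<And>v w. v \<in> N \<Longrightarrow> w \<in> N \<Longrightarrow> Im (cnj (z v) * z w) = 0"
    by blast
  have "finite N" "N \<noteq> {}"
    using assms card.infinite by force+
  then obtain v where "v \<in> N"
    by blast
  define B where "B = {w \<in> N. cnj (z v) * z w = -1}"
  have "B \<subseteq> N"
    by (simp add: B_def)
  have sign: "cnj (z v) * z w = (if w \<in> B then - 1 else 1)" if "w \<in> N" for w
  proof -
    have "cmod (cnj (z v) * z w) = 1"
      using assms by (simp add: norm_mult on_torus_def)
    then have "\<bar>Re (cnj (z v) * z w)\<bar> = 1"
      using collinear[OF \<open>v \<in> N\<close> that] by (simp add: cmod_eq_Re)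
    then show ?thesis
      using collinear[OF \<open>v \<in> N\<close> that] that by (auto simp: B_def complex_eq_iff)
  qed
  have "0 = (\<Sum>w\<in>N. cnj (z v) * z w)"
    using assms by (simp flip: sum_distrib_left)
  also have "\<dots> = (\<Sum>w\<in>N. if w \<in> B then - 1 else 1)"
    using sign by simp
  also have "\<dots> = of_nat (card (N - B)) - of_nat (card B)"
    using \<open>finite N\<close> \<open>B \<subseteq> N\<close> by (simp add: sum.If_cases Int_absorb1 Diff_eq)
  finally have "card (N - B) = card B"
    by simp
  moreover have "card N = card (N - B) + card B"
    using \<open>finite N\<close> \<open>B \<subseteq> N\<close> by (metis card_Diff_subset card_mono finite_subset le_add_diff_inverse2)
  ultimately show False
    using assms by simp
qed

section \<open>Constrained critical points\<close>

lemma energy_bounded_on_torus: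
  obtains K where "\<And>z. on_torus z \<Longrightarrow> \<bar>energy m z\<bar> \<le> K"
proof
  fix z :: "'a \<Rightarrow> complex"
  assume z: "on_torus z"
  have "\<bar>energy m z\<bar> \<le> (\<Sum>v\<in>UNIV. \<bar>Re (cnj (z v) * field_at m z v)\<bar>)"
    unfolding energy_def by (rule sum_abs)
  also have "\<dots> \<le> (\<Sum>v\<in>UNIV. \<Sum>w\<in>UNIV. \<bar>m v w\<bar>)"
  proof (rule sum_mono)
    fix v
    have "\<bar>Re (cnj (z v) * field_at m z v)\<bar> \<le> cmod (field_at m z v)"
      using abs_Re_le_cmod[of "cnj (z v) * field_at m z v"] z by (simp add: norm_mult on_torus_def)
    also have "\<dots> \<le> (\<Sum>w\<in>UNIV. \<bar>m v w\<bar>)"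
      unfolding field_at_def using z by (intro sum_norm_le) (simp add: norm_mult on_torus_def)
    finally show "\<bar>Re (cnj (z v) * field_at m z v)\<bar> \<le> (\<Sum>w\<in>UNIV. \<bar>m v w\<bar>)" .
  qed
  finally show "\<bar>energy m z\<bar> \<le> (\<Sum>v\<in>UNIV. \<Sum>w\<in>UNIV. \<bar>m v w\<bar>)" .
qed

text \<open>
  A plane vector is determined by its cross products with two independent vectors.
\<close>

lemma cramer_two_directions:
  fixes u v l :: complex
  assumes "Im (cnj u * v) \<noteq> 0"
  shows "l = (of_real (Im (cnj u * l)) * v - of_real (Im (cnj v * l)) * u) / of_real (Im (cnj u * v))"
proof -
  have "l * of_real (Im (cnj u * v)) =
      of_real (Im (cnj u * l)) * v - of_real (Im (cnj v * l)) * u"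
    by (simp add: complex_eq_iff algebra_simps)
  with assms show ?thesis by (metis nonzero_eq_divide_eq of_real_eq_0_iff)
qed

text \<open>
  A Lagrange multiplier \<open>\<kappa>\<close> for the constraint \<open>(\<Sum>v\<in>N. z v) = 0\<close>, obtained by the penalty method.
  Let \<open>x n\<close> minimise the energy plus \<open>n\<close> times the squared modulus of the constrained sum. The
  penalised energy is again a quadratic form, so \<open>x n\<close> is an equilibrium in the above sense, with
  \<open>n\<close> times the constrained sum as approximate multiplier. Boundedness of the energy forces the
  constrained sum to \<open>0\<close>. The equilibrium conditions at two vertices of \<open>N\<close> express the approximate
  multiplier by Cramer's rule, and they do so with a nonzero determinant in the limit because \<open>N\<close>
  is odd; hence the approximate multipliers converge.
\<close>

lemma constrained_critical_point_odd:
  fixes m :: "'v::finite \<Rightarrow> 'v \<Rightarrow> real"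
  assumes sym: "\<And>v w. m v w = m w v" and N: "card N \<ge> 2" "odd (card N)"
  obtains z \<kappa> where "on_torus z" "(\<Sum>v\<in>N. z v) = 0"
    "\<And>v. Im (cnj (z v) * (field_at m z v + (if v \<in> N then \<kappa> else 0))) = 0"
proof -
  define p where "p n v w = m v w + (if v \<in> N \<and> w \<in> N then real n else 0)" for n v w
  define \<Sigma> where "\<Sigma> z = (\<Sum>v\<in>N. z v)" for z :: "'v \<Rightarrow> complex"
  have field_p: "field_at (p n) z v = field_at m z v + (if v \<in> N then of_nat n * \<Sigma> z else 0)"
    for n z v
    by (cases "v \<in> N") (simp_all add: field_at_def p_def \<Sigma>_def algebra_simps sum.distrib
        sum_distrib_left if_distrib[of of_real] if_distrib[of "\<lambda>x. _ * x"] sum.If_cases cong: if_cong)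
  have energy_p: "energy (p n) z = energy m z + real n * (cmod (\<Sigma> z))\<^sup>2" for n z
  proof -
    have "energy (p n) z = energy m z + (\<Sum>v\<in>N. Re (cnj (z v) * (of_nat n * \<Sigma> z)))"
      by (simp add: energy_def field_p ring_distribs sum.distrib
          if_distrib[of "\<lambda>x. _ * x"] if_distrib[of Re] sum.If_cases cong: if_cong)
    also have "(\<Sum>v\<in>N. Re (cnj (z v) * (of_nat n * \<Sigma> z))) = Re (cnj (\<Sigma> z) * (of_nat n * \<Sigma> z))"
      unfolding \<Sigma>_def by (simp only: Re_sum[symmetric] sum_distrib_right[symmetric] cnj_sum)
    also have "\<dots> = real n * (cmod (\<Sigma> z))\<^sup>2"
      unfolding cmod_power2 by (simp add: algebra_simps power2_eq_square)
    finally show ?thesis .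
  qed
  have "\<exists>z. on_torus z \<and> (\<forall>y. on_torus y \<longrightarrow> energy (p n) z \<le> energy (p n) y)" for n
    using energy_minimum_exists[of "p n"] by metis
  then obtain x where x: "\<And>n. on_torus (x n)"
    and x_min: "\<And>n y. on_torus y \<Longrightarrow> energy (p n) (x n) \<le> energy (p n) y"
    by metis
  have critical: "Im (cnj (x n v) * (field_at m (x n) v + (if v \<in> N then of_nat n * \<Sigma> (x n) else 0))) = 0"
    for n v
    using energy_minimum_imp_critical[of "p n" "x n" v] x x_min sym
    by (simp add: p_def field_p conj_commute)
  obtain y where y: "on_torus y" "\<Sigma> y = 0"
    using zero_sum_on_torus[OF N(1)] unfolding \<Sigma>_def by metis
  obtain K where K: "\<And>z. on_torus z \<Longrightarrow> \<bar>energy m z\<bar> \<le> K"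
    using energy_bounded_on_torus by metis
  have penalty: "real n * (cmod (\<Sigma> (x n)))\<^sup>2 \<le> 2 * K" for n
    using x_min[OF y(1), of n] K[OF y(1)] K[OF x[of n]] y(2) by (simp add: energy_p)
  obtain r z where r: "strict_mono r" and z: "on_torus z" and lim: "\<And>v. (\<lambda>n. x (r n) v) \<longlonglongrightarrow> z v"
    using on_torus_sequence_limit[of x, OF x] by blast
  have "\<Sigma> z = 0"
  proof -
    have lim1: "(\<lambda>n. (cmod (\<Sigma> (x (r n))))\<^sup>2) \<longlonglongrightarrow> (cmod (\<Sigma> z))\<^sup>2"
      unfolding \<Sigma>_def by (intro tendsto_intros lim)
    have lim2: "(\<lambda>n. (cmod (\<Sigma> (x (r n))))\<^sup>2) \<longlonglongrightarrow> 0"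
    proof (rule tendsto_sandwich[OF _ _ tendsto_const])
      have bound: "(cmod (\<Sigma> (x (r n))))\<^sup>2 \<le> 2 * K / real n" if "n > 0" for n
      proof -
        have "real n * (cmod (\<Sigma> (x (r n))))\<^sup>2 \<le> real (r n) * (cmod (\<Sigma> (x (r n))))\<^sup>2"
          using seq_suble[OF r, of n] by (intro mult_right_mono) auto
        then show ?thesis
          using penalty[of "r n"] that by (simp add: field_simps)
      qed
      then show "\<forall>\<^sub>F n in sequentially. (cmod (\<Sigma> (x (r n))))\<^sup>2 \<le> 2 * K / real n"
        by (intro eventually_sequentiallyI[of 1]) auto
      show "(\<lambda>n. 2 * K / real n) \<longlonglongrightarrow> 0"
        by (rule lim_const_over_n)
    qed simp
    show ?thesis
      using LIMSEQ_unique[OF lim1 lim2] by simp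
  qed
  then obtain a b where ab: "a \<in> N" "b \<in> N" "Im (cnj (z a) * z b) \<noteq> 0"
    using odd_zero_sum_imp_not_collinear[OF N(2) z] unfolding \<Sigma>_def by metis
  define \<mu> where "\<mu> n = of_nat (r n) * \<Sigma> (x (r n))" for n
  define f where "f n v = field_at m (x (r n)) v" for n v
  define D where "D n = Im (cnj (x (r n) a) * x (r n) b)" for n
  have lim_f: "(\<lambda>n. f n v) \<longlonglongrightarrow> field_at m z v" for v
    unfolding f_def field_at_def by (intro tendsto_intros lim)
  have lim_D: "D \<longlonglongrightarrow> Im (cnj (z a) * z b)"
    unfolding D_def by (intro tendsto_intros lim)
  have \<mu>_direction: "Im (cnj (x (r n) v) * \<mu> n) = - Im (cnj (x (r n) v) * f n v)" if "v \<in> N" for n v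
    using critical[of "r n" v] that by (simp add: \<mu>_def f_def algebra_simps)
  define F where "F n = (of_real (- Im (cnj (x (r n) a) * f n a)) * x (r n) b -
      of_real (- Im (cnj (x (r n) b) * f n b)) * x (r n) a) / of_real (D n)" for n
  define \<kappa> where "\<kappa> = (of_real (- Im (cnj (z a) * field_at m z a)) * z b -
      of_real (- Im (cnj (z b) * field_at m z b)) * z a) / of_real (Im (cnj (z a) * z b))"
  have lim_F: "F \<longlonglongrightarrow> \<kappa>"
    unfolding F_def \<kappa>_def by (intro tendsto_intros lim lim_f lim_D) (use ab(3) of_real_eq_0_iff in blast)
  have "\<forall>\<^sub>F n in sequentially. D n \<noteq> 0"
    using lim_D ab(3) by (rule tendsto_imp_eventually_ne)
  then have ev: "\<forall>\<^sub>F n in sequentially. F n = \<mu> n"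
  proof eventually_elim
    case (elim n)
    then show ?case
      using cramer_two_directions[of "x (r n) a" "x (r n) b" "\<mu> n"]
      unfolding \<mu>_direction[OF ab(1)] \<mu>_direction[OF ab(2)] F_def D_def by simp
  qed
  have lim_\<mu>: "\<mu> \<longlonglongrightarrow> \<kappa>"
    by (rule Lim_transform_eventually[OF lim_F ev])
  show ?thesis
  proof (rule that[of z \<kappa>])
    fix v
    have lim0: "(\<lambda>n. Im (cnj (x (r n) v) * (f n v + (if v \<in> N then \<mu> n else 0)))) \<longlonglongrightarrow>
        Im (cnj (z v) * (field_at m z v + (if v \<in> N then \<kappa> else 0)))"
      by (cases "v \<in> N") (auto intro!: tendsto_intros lim lim_f lim_\<mu>)
    moreover have "Im (cnj (x (r n) v) * (f n v + (if v \<in> N then \<mu> n else 0))) = 0" for n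
      using critical[of "r n" v] by (simp only: f_def \<mu>_def)
    ultimately have "(\<lambda>_. 0) \<longlonglongrightarrow> Im (cnj (z v) * (field_at m z v + (if v \<in> N then \<kappa> else 0)))"
      by (simp only:)
    then show "Im (cnj (z v) * (field_at m z v + (if v \<in> N then \<kappa> else 0))) = 0"
      by (simp add: LIMSEQ_const_iff)
  qed (use z \<open>\<Sigma> z = 0\<close> in \<open>simp_all add: \<Sigma>_def\<close>)
qed

text \<open>
  For even \<open>N\<close> the constraint has singular points, but there all phases may be taken real: then
  every field is real as well, and the multiplier \<open>0\<close> works.
\<close>

lemma constrained_critical_point:
  fixes m :: "'v::finite \<Rightarrow> 'v \<Rightarrow> real"
  assumes sym: "\<And>v w. m v w = m w v" and N: "card N \<ge> 2"
  obtains z \<kappa> where "on_torus z" "(\<Sum>v\<in>N. z v) = 0"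
    "\<And>v. Im (cnj (z v) * (field_at m z v + (if v \<in> N then \<kappa> else 0))) = 0"
proof (cases "even (card N)")
  case True
  then obtain z :: "'v \<Rightarrow> complex" where z: "\<And>v. z v = 1 \<or> z v = -1" "(\<Sum>v\<in>N. z v) = 0"
    using zero_sum_signs by (metis finite)
  have "Im (z v) = 0" and "cmod (z v) = 1" for v
    using z(1)[of v] by auto
  then show ?thesis
    using z(2) by (intro that[of z 0]) (simp_all add: on_torus_def field_at_def)
qed (use constrained_critical_point_odd[of m N] assms that in blast)

section \<open>Three unit vectors with prescribed sum\<close>

text \<open>
  Three variables subject to two equations leave one parameter, for which the third number
  serves. With sum \<open>\<kappa> - r\<close> and sum of inverses \<open>cnj \<kappa> - 1 / r\<close> prescribed, the other two have
  product \<open>(\<kappa> - r) * r / (cnj \<kappa> * r - 1)\<close>, so they are the roots of a quadratic equation. Its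
  discriminant has a holomorphic square root on a small disc avoiding the zeros and poles
  involved. Three unit vectors cannot add up to \<open>\<kappa>\<close> once \<open>cmod \<kappa> > 3\<close>; this is where
  complex angles matter.
\<close>

lemma holomorphic_triple_curve:
  fixes \<kappa> :: complex
  obtains D f g s t where "open D" "topological_space_class.connected D"
    "f holomorphic_on D" "g holomorphic_on D" "s \<in> D" "t \<in> D" "s \<noteq> t"
    "\<forall>r\<in>D. r \<noteq> 0 \<and> f r \<noteq> 0 \<and> g r \<noteq> 0"
    "\<forall>r\<in>D. f r + g r + r = \<kappa>"
    "\<forall>r\<in>D. inverse (f r) + inverse (g r) + inverse r = cnj \<kappa>"
proof -
  \<comment> \<open>The numerator of the discriminant, up to the factor \<open>\<kappa> - r\<close>.\<close>
  define Q where "Q = [: - \<kappa>, \<kappa> * cnj \<kappa> - 3, - cnj \<kappa> :]"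
  \<comment> \<open>The zeros of \<open>P\<close> are the parameters at which one of the three numbers vanishes or has a pole,
      or at which the discriminant vanishes.\<close>
  define P where "P = [: 0, 1 :] * [: \<kappa>, - 1 :] * [: - 1, cnj \<kappa> :] * Q"
  have "Q \<noteq> 0"
    by (auto simp: Q_def)
  then have "P \<noteq> 0"
    unfolding P_def by (simp only: mult_eq_0_iff) simp
  then have "infinite (- {s. poly P s = 0})"
    using poly_roots_finite infinite_UNIV_char_0 by (metis finite_compl)
  then obtain s where s: "poly P s \<noteq> 0"
    by (metis (mono_tags, lifting) ComplD equals0I finite.emptyI mem_Collect_eq)
  have "open {s. poly P s \<noteq> 0}"
    by (intro open_Collect_neq continuous_intros)
  then obtain e where e: "e > 0" "ball s e \<subseteq> {s. poly P s \<noteq> 0}"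
    using s open_contains_ball by (metis (mono_tags, lifting) mem_Collect_eq)
  define D where "D = ball s e"
  have nz: "r \<noteq> 0" "\<kappa> - r \<noteq> 0" "cnj \<kappa> * r - 1 \<noteq> 0" "poly Q r \<noteq> 0" if "r \<in> D" for r
  proof -
    have "poly P r = r * (\<kappa> - r) * (cnj \<kappa> * r - 1) * poly Q r"
      by (simp add: P_def algebra_simps)
    moreover have "poly P r \<noteq> 0"
      using that e(2) by (auto simp: D_def)
    ultimately show "r \<noteq> 0" "\<kappa> - r \<noteq> 0" "cnj \<kappa> * r - 1 \<noteq> 0" "poly Q r \<noteq> 0"
      by auto
  qed
  define disc where "disc r = (\<kappa> - r) * poly Q r / (cnj \<kappa> * r - 1)" for r
  have disc_hol: "disc holomorphic_on D"
    unfolding disc_def Q_def using nz by (auto intro!: holomorphic_intros)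
  have disc_nz: "disc r \<noteq> 0" if "r \<in> D" for r
    using nz[OF that] by (simp add: disc_def)
  have "contractible D"
    by (simp add: D_def convex_imp_contractible)
  then have "\<exists>q. q holomorphic_on D \<and> (\<forall>r\<in>D. disc r = q r ^ 2)"
    by (rule contractible_imp_holomorphic_sqrt[OF disc_hol _ disc_nz]) blast+
  then obtain q where q_hol: "q holomorphic_on D" and q_sq: "\<forall>r\<in>D. disc r = q r ^ 2"
    by blast
  define f where "f r = (\<kappa> - r + q r) / 2" for r
  define g where "g r = (\<kappa> - r - q r) / 2" for r
  have sum: "f r + g r = \<kappa> - r" for r
    by (simp add: f_def g_def field_simps)
  have prod: "f r * g r = (\<kappa> - r) * r / (cnj \<kappa> * r - 1)" if "r \<in> D" for r
  proof -
    have "4 * (f r * g r) = (\<kappa> - r)\<^sup>2 - disc r"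
      unfolding bspec[OF q_sq that] by (simp add: f_def g_def power2_eq_square field_simps)
    also have "\<dots> = 4 * ((\<kappa> - r) * r / (cnj \<kappa> * r - 1))"
      using nz(3)[OF that] by (simp add: disc_def Q_def field_simps power2_eq_square)
    finally show ?thesis
      by (simp only: mult_cancel_left) simp
  qed
  have f_g_nz: "f r \<noteq> 0" "g r \<noteq> 0" if "r \<in> D" for r
    using prod[OF that] nz[OF that] by auto
  show ?thesis
  proof (rule that[of D f g s "s + of_real (e / 2)"])
    show "open D" "topological_space_class.connected D"
      by (simp_all add: D_def)
    show "f holomorphic_on D" "g holomorphic_on D"
      unfolding f_def g_def by (intro holomorphic_intros q_hol; simp)+
    show "s \<in> D" "s + of_real (e / 2) \<in> D" "s \<noteq> s + of_real (e / 2)"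
      using e by (auto simp: D_def dist_norm)
    show "\<forall>r\<in>D. r \<noteq> 0 \<and> f r \<noteq> 0 \<and> g r \<noteq> 0"
      using nz(1) f_g_nz by blast
    show "\<forall>r\<in>D. f r + g r + r = \<kappa>"
      by (simp add: sum)
    show "\<forall>r\<in>D. inverse (f r) + inverse (g r) + inverse r = cnj \<kappa>"
    proof
      fix r
      assume r: "r \<in> D"
      have "inverse (f r) + inverse (g r) = (f r + g r) / (f r * g r)"
        using f_g_nz[OF r] by (simp add: field_simps)
      also have "\<dots> = (cnj \<kappa> * r - 1) / r"
        unfolding sum prod[OF r] using nz[OF r] by simp
      finally show "inverse (f r) + inverse (g r) + inverse r = cnj \<kappa>"
        using nz(1)[OF r] by (simp add: field_simps)
    qed
  qed
qed

section \<open>The Kuramoto variety in exponential coordinates\<close>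

text \<open>
  Cosine and sine of the complex angle whose exponential \<open>exp (\<i> * \<theta>)\<close> is \<open>Z v\<close>. In this coordinate
  rotations act by scaling and the circle equations hold by themselves.
\<close>

definition phase_coords :: "('v \<Rightarrow> complex) \<Rightarrow> 'v kvar \<Rightarrow> complex" where
  "phase_coords Z i =
     (case i of X v \<Rightarrow> (Z v + inverse (Z v)) / 2 | Y v \<Rightarrow> (Z v - inverse (Z v)) / (2 * \<i>))"

lemma phase_coords_inject: "phase_coords Z = phase_coords Z' \<longleftrightarrow> Z = Z'"
proof
  assume eq: "phase_coords Z = phase_coords Z'"
  have "Z v = phase_coords Z (X v) + \<i> * phase_coords Z (Y v)" for Z :: "'a \<Rightarrow> complex" and v
    by (simp add: phase_coords_def field_simps)
  with eq show "Z = Z'"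
    by (metis ext)
qed simp

text \<open>
  In exponential coordinates \<open>x\<^sub>w y\<^sub>v - x\<^sub>v y\<^sub>w\<close> is the sine of a difference of two angles, that is
  \<open>(Z v / Z w - Z w / Z v) / (2 * \<i>)\<close>.
\<close>

lemma phase_coords_in_kuramoto_variety:
  assumes nz: "\<And>v. Z v \<noteq> 0"
    and eqs: "\<And>v. v \<in> pverts G \<Longrightarrow>
      (\<Sum>w\<in>nbhd G v. Z w) / Z v = (\<Sum>w\<in>nbhd G v. inverse (Z w)) * Z v"
  shows "phase_coords Z \<in> kuramoto_variety G"
proof -
  have theta: "(phase_coords Z (X v))\<^sup>2 + (phase_coords Z (Y v))\<^sup>2 = 1" for v
    using nz[of v] by (simp add: phase_coords_def field_simps power2_eq_square)
  have wedge: "phase_coords Z (X w) * phase_coords Z (Y v) - phase_coords Z (X v) * phase_coords Z (Y w) =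
      (inverse (Z w) * Z v - Z w / Z v) / (2 * \<i>)" for v w
    using nz[of v] nz[of w] by (simp add: phase_coords_def field_simps)
  have "peval (phase_coords Z) (kuramoto_poly G v) = 0" if "v \<in> pverts G" for v
  proof -
    have "peval (phase_coords Z) (kuramoto_poly G v) =
        ((\<Sum>w\<in>nbhd G v. inverse (Z w)) * Z v - (\<Sum>w\<in>nbhd G v. Z w) / Z v) / (2 * \<i>)"
      by (simp only: kuramoto_poly_def peval_simps wedge sum_divide_distrib sum_distrib_right
          sum_subtractf[symmetric])
    then show ?thesis
      using eqs[OF that] by simp
  qed
  then show ?thesis
    unfolding kuramoto_variety_def I_kuramoto_def I_theta_def I_graph_def zero_locus_ideal_sum
    by (auto simp: zero_locus_def peval_simps theta)
qed

lemma zariski_closed_normalized_kuramoto_variety: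
  fixes G :: "'v::finite pair_pre_digraph"
  shows "zariski_closed (kuramoto_variety G \<inter> {a. a (X v0) = 1 \<and> a (Y v0) = 0})"
  unfolding zariski_closed_def
proof
  show "kuramoto_variety G \<inter> {a. a (X v0) = 1 \<and> a (Y v0) = 0} =
      zero_locus (I_kuramoto G \<union> {pvar (X v0) - 1, pvar (Y v0)})"
    by (auto simp: kuramoto_variety_def zero_locus_def peval_simps)
qed

text \<open>
  Dividing all phases by the one at \<open>v0\<close> normalises the angle there. The hypothesis on \<open>u\<close> and \<open>v\<close>
  concerns a ratio of phases, so that it survives this division whichever vertex \<open>v0\<close> is.
\<close>

lemma alg_dim_normalized_ge_1_if_phase_curve:
  fixes G :: "'v::finite pair_pre_digraph"
  assumes D: "open D" "topological_space_class.connected D"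
    and hol: "\<And>v. (\<lambda>s. Z s v) holomorphic_on D"
    and nz: "\<And>s v. s \<in> D \<Longrightarrow> Z s v \<noteq> 0"
    and eqs: "\<And>s v. s \<in> D \<Longrightarrow> v \<in> pverts G \<Longrightarrow>
      (\<Sum>w\<in>nbhd G v. Z s w) / Z s v = (\<Sum>w\<in>nbhd G v. inverse (Z s w)) * Z s v"
    and st: "s \<in> D" "t \<in> D" and rel: "Z s u / Z s v \<noteq> Z t u / Z t v"
  shows "alg_dim (kuramoto_variety G \<inter> {a. a (X v0) = 1 \<and> a (Y v0) = 0}) \<ge> 1"
proof (rule alg_dim_ge_1_if_holomorphic_curve)
  define W where "W s v = Z s v / Z s v0" for s v
  show "zariski_closed (kuramoto_variety G \<inter> {a. a (X v0) = 1 \<and> a (Y v0) = 0})"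
    by (rule zariski_closed_normalized_kuramoto_variety)
  show "open D" "topological_space_class.connected D" "s \<in> D" "t \<in> D"
    by fact+
  have "phase_coords (W r) \<in> kuramoto_variety G" if "r \<in> D" for r
  proof (rule phase_coords_in_kuramoto_variety)
    show "W r v \<noteq> 0" for v
      using nz[OF that] by (simp add: W_def)
    fix v
    assume "v \<in> pverts G"
    have "(\<Sum>w\<in>nbhd G v. W r w) / W r v = (\<Sum>w\<in>nbhd G v. Z r w) / Z r v"
      using nz[OF that] by (simp add: W_def flip: sum_divide_distrib)
    also have "\<dots> = (\<Sum>w\<in>nbhd G v. inverse (Z r w)) * Z r v"
      by (rule eqs) fact+
    also have "\<dots> = (\<Sum>w\<in>nbhd G v. inverse (Z r w) * Z r v0) * W r v"
      using nz[OF that] by (simp add: W_def flip: sum_distrib_right)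
    finally show "(\<Sum>w\<in>nbhd G v. W r w) / W r v = (\<Sum>w\<in>nbhd G v. inverse (W r w)) * W r v"
      by (simp add: W_def field_simps)
  qed
  then show "(\<lambda>r. phase_coords (W r)) ` D \<subseteq> kuramoto_variety G \<inter> {a. a (X v0) = 1 \<and> a (Y v0) = 0}"
    using nz by (auto simp: phase_coords_def W_def)
  show "(\<lambda>r. phase_coords (W r) i) holomorphic_on D" for i
    unfolding phase_coords_def W_def
    by (cases i) (auto intro!: holomorphic_intros hol simp: nz)
  have "W r u / W r v = Z r u / Z r v" if "r \<in> D" for r
    using nz[OF that] by (simp add: W_def)
  then show "phase_coords (W s) \<noteq> phase_coords (W t)"
    unfolding phase_coords_inject using rel st by metis
qed

theorem corollary2p9:
  fixes G :: "'v::finite pair_pre_digraph" and v0 :: 'v and k :: nat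
  assumes "pverts G = UNIV"
    and "sct_graph G"
    and "k \<ge> 3"
    and "\<exists>S. klet G k S"
  shows "alg_dim (kuramoto_variety G \<inter> {a. a (X v0) = 1 \<and> a (Y v0) = 0}) \<ge> 1"
proof -
  interpret pair_graph G
    using assms by (simp add: sct_graph_def)
  have nbhd_sym: "w \<in> nbhd G v \<longleftrightarrow> v \<in> nbhd G w" for v w
    unfolding nbhd_def using arcs_symmetric by blast
  have nbhd_irrefl: "v \<notin> nbhd G v" for v
    unfolding nbhd_def using no_loops' by blast
  obtain S where S: "klet G k S"
    using assms by blast
  then obtain T where "T \<subseteq> S" "card T = 3"
    using \<open>k \<ge> 3\<close> by (metis klet_def obtain_subset_with_card_n)
  then obtain a b c where T: "T = {a, b, c}" "a \<noteq> b" "a \<noteq> c" "b \<noteq> c"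
    by (metis card_3_iff)
  define N where "N = nbhd G a"
  have nbhd_T: "nbhd G v = N" if "v \<in> T" for v
    using S \<open>T \<subseteq> S\<close> T that unfolding N_def klet_def by blast
  have N_T: "N \<inter> T = {}"
    using nbhd_T nbhd_irrefl by blast
  have "card N \<ge> 2"
    using assms by (simp add: N_def sct_graph_def)
  have nbhd_inter_T: "nbhd G v \<inter> T = (if v \<in> N then T else {})" for v
    using nbhd_sym nbhd_T by auto
  \<comment> \<open>The coupling of the graph that remains when the three vertices are deleted. Their effect on the
      rest is summarised by the multiplier \<open>\<kappa>\<close>.\<close>
  define m :: "'v \<Rightarrow> 'v \<Rightarrow> real" where
    "m v w = (if v \<notin> T \<and> w \<in> nbhd G v - T then 1 else 0)" for v w
  have "m v w = m w v" for v w
    using nbhd_sym by (simp add: m_def)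
  then obtain z \<kappa> where z: "on_torus z" and sum_N: "(\<Sum>v\<in>N. z v) = 0"
    and critical: "\<And>v. Im (cnj (z v) * (field_at m z v + (if v \<in> N then \<kappa> else 0))) = 0"
    using constrained_critical_point[of m N] \<open>card N \<ge> 2\<close> by blast
  have unit: "cmod (z v) = 1" for v
    using z by (simp add: on_torus_def)
  have z_nz: "z v \<noteq> 0" for v
    using unit[of v] by auto
  have inverse_z: "inverse (z v) = cnj (z v)" for v
    using complex_norm_square[of "z v"] unit[of v] by (intro inverse_unique) simp
  have field_m: "field_at m z v = (\<Sum>w\<in>nbhd G v - T. z w)" if "v \<notin> T" for v
    using that by (simp add: field_at_def m_def if_distrib[of of_real] if_distrib[of "\<lambda>x. x * _"]
        sum.If_cases set_diff_eq cong: if_cong)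
  obtain D f g s t where D: "open D" "topological_space_class.connected D"
    and hol: "f holomorphic_on D" "g holomorphic_on D" and st: "s \<in> D" "t \<in> D" "s \<noteq> t"
    and nz: "\<forall>r\<in>D. r \<noteq> 0 \<and> f r \<noteq> 0 \<and> g r \<noteq> 0"
    and sum1: "\<forall>r\<in>D. f r + g r + r = \<kappa>"
    and sum2: "\<forall>r\<in>D. inverse (f r) + inverse (g r) + inverse r = cnj \<kappa>"
    by (rule holomorphic_triple_curve[of \<kappa>]) (rule that)
  define Z where "Z s = z(a := f s, b := g s, c := s)" for s
  have Z_T: "Z r v = z v" if "v \<notin> T" for r v
    using that by (simp add: Z_def T)
  have sum_nbhd: "(\<Sum>w\<in>nbhd G v. h (Z r w)) =
      (\<Sum>w\<in>nbhd G v - T. h (z w)) + (if v \<in> N then h (f r) + h (g r) + h r else 0)"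
    for h :: "complex \<Rightarrow> complex" and r v
  proof -
    have "(\<Sum>w\<in>nbhd G v. h (Z r w)) =
        (\<Sum>w\<in>nbhd G v - T. h (Z r w)) + (\<Sum>w\<in>nbhd G v \<inter> T. h (Z r w))"
      by (subst sum.Int_Diff[of _ _ T]) (simp_all add: add.commute)
    moreover have "(\<Sum>w\<in>T. h (Z r w)) = h (f r) + h (g r) + h r"
      using T by (simp add: Z_def algebra_simps)
    ultimately show ?thesis
      by (simp add: nbhd_inter_T Z_T)
  qed
  \<comment> \<open>A vertex whose phase stays fixed, against which the motion of \<open>c\<close> is visible.\<close>
  have "N \<noteq> {}"
    using \<open>card N \<ge> 2\<close> by auto
  then obtain d where "d \<in> N"
    by blast
  then have "d \<notin> T"
    using N_T by blast
  show ?thesis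
  proof (rule alg_dim_normalized_ge_1_if_phase_curve[of D Z])
    show "open D" "topological_space_class.connected D" "s \<in> D" "t \<in> D"
      by fact+
    show "(\<lambda>r. Z r v) holomorphic_on D" for v
      using hol unfolding Z_def fun_upd_def
      by (cases "v = c"; cases "v = b"; cases "v = a") (simp_all add: holomorphic_on_ident)
    show "Z s c / Z s d \<noteq> Z t c / Z t d"
      using st(3) z_nz Z_T[OF \<open>d \<notin> T\<close>] by (simp add: Z_def)
    fix r
    assume r: "r \<in> D"
    show "Z r v \<noteq> 0" for v
      using bspec[OF nz r] z_nz by (simp add: Z_def)
    fix v
    show "(\<Sum>w\<in>nbhd G v. Z r w) / Z r v = (\<Sum>w\<in>nbhd G v. inverse (Z r w)) * Z r v"
    proof (cases "v \<in> T")
      case True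
      then have "v \<notin> N" and "N - T = N"
        using N_T by auto
      then have "(\<Sum>w\<in>nbhd G v. Z r w) = 0"
        using sum_nbhd[of "\<lambda>x. x" r v] sum_N nbhd_T[OF True] by simp
      moreover have "(\<Sum>w\<in>nbhd G v. inverse (Z r w)) = cnj (\<Sum>w\<in>N. z w)"
        using sum_nbhd[of inverse r v] \<open>v \<notin> N\<close> \<open>N - T = N\<close> nbhd_T[OF True]
        by (simp add: inverse_z)
      ultimately show ?thesis
        using sum_N by simp
    next
      case False
      define E where "E = field_at m z v + (if v \<in> N then \<kappa> else 0)"
      have "(\<Sum>w\<in>nbhd G v. Z r w) = E"
        using sum_nbhd[of "\<lambda>x. x" r v] bspec[OF sum1 r] by (simp add: E_def field_m[OF False])
      moreover have "(\<Sum>w\<in>nbhd G v. inverse (Z r w)) = cnj E"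
        using sum_nbhd[of inverse r v] bspec[OF sum2 r]
        by (simp add: E_def field_m[OF False] inverse_z)
      moreover have "cnj (z v) * E = z v * cnj E"
        using critical[of v] by (simp add: E_def[symmetric] complex_eq_iff)
      ultimately show ?thesis
        by (simp add: Z_T[OF False] divide_inverse inverse_z mult.commute)
    qed
  qed
qed

end
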